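(* Let $S$ be a signed graph whose underlying graph is simple and connected and all of whose edges are negative. Then $S$ is a parity signed graph if and only if its underlying graph is a spanning subgraph of a complete bipartite graph $K_{m,n}$ with $|m-n|\le 1$.
   Context: A signed graph is a pair $S=(G,\sigma)$ with $G$ a graph and $\sigma:E(G)\to\{+,-\}$. For a graph $G$ with $n$ vertices and a bijection $f:V(G)\to\{1,\dots,n\}$, define $\sigma_f(uv)=+$ if $f(u),f(v)$ have the same parity and $\sigma_f(uv)=-$ otherwise. $S$ is a parity signed graph if $\sigma=\sigma_f$ for some such bijection $f$. *)

theory Defs
  imports "Graph_Theory.Kuratowski"
begin

datatype sign = Pos | Neg

text \<open>
  A finite simple graph is a symmetric loop-free digraph (\<^locale>\<open>pair_graph\<close>): the edge \<open>uv\<close> is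
  the pair of arcs \<open>(u, v)\<close> and \<open>(v, u)\<close>. The signature of a signed graph is a function of the
  undirected edge \<open>{u, v}\<close>, so both arcs of an edge carry the same sign; its values on sets that
  are not edges are irrelevant.
\<close>

type_synonym 'a signed_graph = "'a pair_pre_digraph \<times> ('a set \<Rightarrow> sign)"

abbreviation underlying_graph :: "'a signed_graph \<Rightarrow> 'a pair_pre_digraph" where
  "underlying_graph S \<equiv> fst S"

abbreviation signature :: "'a signed_graph \<Rightarrow> 'a set \<Rightarrow> sign" where
  "signature S \<equiv> snd S"

definition all_negative :: "'a signed_graph \<Rightarrow> bool" where
  "all_negative S \<longleftrightarrow> (\<forall>(u, v) \<in> parcs (underlying_graph S). signature S {u, v} = Neg)"

definition parity_sign :: "('a \<Rightarrow> nat) \<Rightarrow> 'a \<Rightarrow> 'a \<Rightarrow> sign" where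
  "parity_sign f u v = (if even (f u) \<longleftrightarrow> even (f v) then Pos else Neg)"

definition parity_signed_graph :: "'a signed_graph \<Rightarrow> bool" where
  "parity_signed_graph S \<longleftrightarrow>
    (\<exists>f. bij_betw f (pverts (underlying_graph S)) {1..card (pverts (underlying_graph S))} \<and>
         (\<forall>(u, v) \<in> parcs (underlying_graph S). signature S {u, v} = parity_sign f u v))"

end

theory Submission
  imports Defs
begin

lemma card_odd_atLeastAtMost: "card {i \<in> {1..N}. odd i} = (N + 1) div 2"
proof (induction N)
  case (Suc N)
  have "{i \<in> {1..Suc N}. odd i} =
      (if odd (Suc N) then insert (Suc N) {i \<in> {1..N}. odd i} else {i \<in> {1..N}. odd i})"
    by (auto simp: le_Suc_eq)
  then show ?case using Suc by auto
qed simp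

lemma card_even_atLeastAtMost: "card {i \<in> {1..N}. even i} = N div 2"
proof (induction N)
  case (Suc N)
  have "{i \<in> {1..Suc N}. even i} =
      (if even (Suc N) then insert (Suc N) {i \<in> {1..N}. even i} else {i \<in> {1..N}. even i})"
    by (auto simp: le_Suc_eq)
  then show ?case using Suc by auto
qed simp

lemma bij_betw_parity_classes:
  assumes "finite U" "finite V" "U \<inter> V = {}" "card V \<le> card U" "card U \<le> card V + 1"
  obtains f where "bij_betw f (U \<union> V) {1..card (U \<union> V)}"
    and "\<forall>u\<in>U. odd (f u)" and "\<forall>v\<in>V. even (f v)"
proof -
  let ?N = "card (U \<union> V)"
  let ?O = "{i \<in> {1..?N}. odd i}" and ?E = "{i \<in> {1..?N}. even i}"
  have N: "?N = card U + card V"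
    using assms by (simp add: card_Un_disjoint)
  have "card U = card ?O" "card V = card ?E"
    unfolding card_odd_atLeastAtMost card_even_atLeastAtMost using N assms(4,5) by linarith+
  then obtain g h where g: "bij_betw g U ?O" and h: "bij_betw h V ?E"
    using assms(1,2) finite_same_card_bij[of U ?O] finite_same_card_bij[of V ?E] by auto
  define f where "f x = (if x \<in> U then g x else h x)" for x
  have fU: "bij_betw f U ?O"
    using g by (simp add: f_def cong: bij_betw_cong)
  have "bij_betw f V ?E \<longleftrightarrow> bij_betw h V ?E"
    using assms(3) by (intro bij_betw_cong) (auto simp: f_def)
  then have fV: "bij_betw f V ?E" using h by simp
  have "bij_betw f (U \<union> V) (?O \<union> ?E)"
    using fU fV by (rule bij_betw_combine) auto
  moreover have "?O \<union> ?E = {1..?N}" by auto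
  ultimately have "bij_betw f (U \<union> V) {1..?N}" by simp
  moreover have "\<forall>u\<in>U. odd (f u)" "\<forall>v\<in>V. even (f v)"
    using bij_betwE[OF fU] bij_betwE[OF fV] by auto
  ultimately show thesis by (rule that)
qed

lemma card_parity_preimages:
  assumes "bij_betw f A {1..N}"
  shows "card {x \<in> A. odd (f x)} = (N + 1) div 2" "card {x \<in> A. even (f x)} = N div 2"
proof -
  have "bij_betw f {x \<in> A. odd (f x)} {i \<in> {1..N}. odd i}"
    and "bij_betw f {x \<in> A. even (f x)} {i \<in> {1..N}. even i}"
    using assms by (auto simp: bij_betw_def inj_on_def)
  then show "card {x \<in> A. odd (f x)} = (N + 1) div 2" "card {x \<in> A. even (f x)} = N div 2"
    using card_odd_atLeastAtMost[of N] card_even_atLeastAtMost[of N]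
    by (auto dest!: bij_betw_same_card)
qed

lemma spanning_with_proj_iff:
  "spanning (with_proj H) (with_proj G) \<longleftrightarrow>
    pverts G = pverts H \<and> parcs H \<subseteq> parcs G \<and> pair_wf_digraph G \<and> pair_wf_digraph H"
  by (auto simp: spanning_def subgraph_def compatible_def wf_digraph_wp_iff)

theorem theorem6:
  fixes S :: "'a signed_graph"
  assumes "pair_graph (underlying_graph S)"
    and "Digraph_Component.connected (with_proj (underlying_graph S))"
    and "all_negative S"
  shows "parity_signed_graph S \<longleftrightarrow>
    (\<exists>(m::nat) (n::nat) (K :: 'a pair_pre_digraph).
       complete_bipartite_digraph m n (with_proj K) \<and>
       spanning (with_proj (underlying_graph S)) (with_proj K) \<and>
       \<bar>int m - int n\<bar> \<le> 1)"
proof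
  let ?G = "underlying_graph S"
  interpret G: pair_graph ?G by fact
  assume "parity_signed_graph S"
  then obtain f where f: "bij_betw f (pverts ?G) {1..card (pverts ?G)}"
    and sgn: "\<And>u v. (u, v) \<in> parcs ?G \<Longrightarrow> signature S {u, v} = parity_sign f u v"
    by (auto simp: parity_signed_graph_def)
  have diff: "even (f u) \<noteq> even (f v)" if "(u, v) \<in> parcs ?G" for u v
    using sgn[OF that] that assms(3)
    by (auto simp: all_negative_def parity_sign_def split: if_splits)
  define U where "U = {x \<in> pverts ?G. odd (f x)}"
  define V where "V = {x \<in> pverts ?G. even (f x)}"
  define K where "K = \<lparr>pverts = pverts ?G, parcs = U \<times> V \<union> V \<times> U\<rparr>"
  have "complete_bipartite_digraph (card U) (card V) (with_proj K)"
    unfolding complete_bipartite_digraph_pair_def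
  proof (intro conjI exI)
    show "finite (pverts K)" by (simp add: K_def G.pair_finite_verts)
    show "pverts K = U \<union> V" "U \<inter> V = {}" by (auto simp: K_def U_def V_def)
    show "parcs K = U \<times> V \<union> V \<times> U" by (simp add: K_def)
  qed simp_all
  moreover have "spanning (with_proj ?G) (with_proj K)"
    unfolding spanning_with_proj_iff
  proof (intro conjI)
    show "parcs ?G \<subseteq> parcs K"
      using diff G.in_arcsD1 G.in_arcsD2 by (auto simp: K_def U_def V_def)
    show "pair_wf_digraph K"
      by unfold_locales (auto simp: K_def U_def V_def)
    show "pair_wf_digraph ?G" by unfold_locales
  qed (simp add: K_def)
  moreover have "\<bar>int (card U) - int (card V)\<bar> \<le> 1"
    unfolding U_def V_def card_parity_preimages[OF f] by linarith
  ultimately show "\<exists>(m::nat) (n::nat) (K :: 'a pair_pre_digraph).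
       complete_bipartite_digraph m n (with_proj K) \<and>
       spanning (with_proj ?G) (with_proj K) \<and> \<bar>int m - int n\<bar> \<le> 1"
    by blast
next
  let ?G = "underlying_graph S"
  assume "\<exists>(m::nat) (n::nat) (K :: 'a pair_pre_digraph).
       complete_bipartite_digraph m n (with_proj K) \<and>
       spanning (with_proj ?G) (with_proj K) \<and> \<bar>int m - int n\<bar> \<le> 1"
  then obtain U V and K :: "'a pair_pre_digraph" where fin: "finite (pverts K)"
    and UV: "pverts K = U \<union> V" "U \<inter> V = {}" "parcs K = U \<times> V \<union> V \<times> U"
    and span: "pverts K = pverts ?G" "parcs ?G \<subseteq> parcs K"
    and le: "\<bar>int (card U) - int (card V)\<bar> \<le> 1"
    unfolding complete_bipartite_digraph_pair_def spanning_with_proj_iff by blast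
  have fins: "finite U" "finite V" using fin UV(1) by auto
  obtain f where f: "bij_betw f (U \<union> V) {1..card (U \<union> V)}"
    and diff: "\<forall>u\<in>U. \<forall>v\<in>V. even (f u) \<noteq> even (f v)"
  proof (cases "card V \<le> card U")
    case True
    moreover have "card U \<le> card V + 1" using le by linarith
    ultimately obtain f where "bij_betw f (U \<union> V) {1..card (U \<union> V)}"
      and "\<forall>u\<in>U. odd (f u)" "\<forall>v\<in>V. even (f v)"
      using bij_betw_parity_classes[OF fins UV(2)] by blast
    then show thesis by (intro that[of f]) auto
  next
    case False
    have "V \<inter> U = {}" using UV(2) by blast
    moreover have "card U \<le> card V" "card V \<le> card U + 1" using False le by linarith+
    ultimately obtain f where "bij_betw f (V \<union> U) {1..card (V \<union> U)}"
      and "\<forall>v\<in>V. odd (f v)" "\<forall>u\<in>U. even (f u)"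
      using bij_betw_parity_classes[OF fins(2,1)] by blast
    then show thesis by (intro that[of f]) (auto simp: Un_commute)
  qed
  have "signature S {u, v} = parity_sign f u v" if "(u, v) \<in> parcs ?G" for u v
  proof -
    have "(u, v) \<in> U \<times> V \<union> V \<times> U" using that span(2) UV(3) by auto
    then have "even (f u) \<noteq> even (f v)" using diff by blast
    then show ?thesis
      using that assms(3) by (auto simp: parity_sign_def all_negative_def)
  qed
  with f show "parity_signed_graph S"
    unfolding parity_signed_graph_def using UV(1) span(1) by auto
qed

end
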